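(* Let $G$ be a profinite group with non-trivial center. Then $G$ does not admit a positive-dimensional faithful action on a regular rooted tree as a self-similar level-transitive closed group. That is, for no integer $m\ge 2$ is there an injective group homomorphism $\rho: G\to\mathrm{Aut}\,T$, where $T$ is the $m$-adic rooted tree, whose image $\rho(G)$ is a closed, self-similar, level-transitive subgroup of $\mathrm{Aut}\,T$ with positive Hausdorff dimension in $\mathrm{Aut}\,T$.
   Context: For $m\ge 2$ the $m$-adic (regular) rooted tree $T$ is identified with the free monoid on $\{1,\dots,m\}$ (vertices are finite words, level $n$ consists of the words of length $n$). $\mathrm{Aut}\,T$ is the group of automorphisms of the rooted tree $T$ (acting on the right), a profinite group whose topology has the level stabilizers as a base of neighbourhoods of $1$; "closed" refers to this topology. For $g\in\mathrm{Aut}\,T$ and a vertex $v$, the section $g|_v\in\mathrm{Aut}\,T$ is defined by $(vu)^g=v^g u^{g|_v}$ for all $u\in T$. For $K\le\mathrm{Aut}\,T$, $\mathrm{St}_K(n)$ is the subgroup of elements of $K$ fixing every vertex of level $n$. $K$ is level-transitive if it acts transitively on every level, and self-similar if $g|_v\in K$ for all $g\in K$, $v\in T$. The Hausdorff dimension of a closed subgroup $K$ in $\mathrm{Aut}\,T$ is with respect to the level-stabilizer filtration: $\mathrm{hdim}_{\mathrm{Aut}\,T}(K)=\liminf_{n\to\infty}\frac{\log|K:\mathrm{St}_K(n)|}{\log|\mathrm{Aut}\,T:\mathrm{St}_{\mathrm{Aut}\,T}(n)|}$. (For $H\le \mathrm{Sym}(m)$ non-trivial and a closed $K$ contained in the iterated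 wreath product $W_H$, i.e. the group of those $g\in\mathrm{Aut}\,T$ all of whose sections act on level 1 by an element of $H$, positivity of the dimension of $K$ in $\mathrm{Aut}\,T$ is equivalent to positivity of its dimension in $W_H$.) *)

theory Defs
  imports
    "HOL-Analysis.Analysis"
    "HOL-Algebra.Coset"
    "HOL-Combinatorics.Permutations"
begin

definition group_center :: "('a, 'b) monoid_scheme \<Rightarrow> 'a set"
  where "group_center G =
    {z \<in> carrier G. \<forall>x \<in> carrier G. z \<otimes>\<^bsub>G\<^esub> x = x \<otimes>\<^bsub>G\<^esub> z}"

definition topological_group :: "('a, 'b) monoid_scheme \<Rightarrow> 'a topology \<Rightarrow> bool"
  where "topological_group G X \<longleftrightarrow>
    group G \<and> topspace X = carrier G \<and>
    continuous_map (prod_topology X X) X (\<lambda>(x, y). x \<otimes>\<^bsub>G\<^esub> y) \<and>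
    continuous_map X X (\<lambda>x. inv\<^bsub>G\<^esub> x)"

definition totally_disconnected :: "'a topology \<Rightarrow> bool"
  where "totally_disconnected X \<longleftrightarrow> (\<forall>C. connectedin X C \<longrightarrow> (\<exists>x. C \<subseteq> {x}))"

definition profinite_group :: "('a, 'b) monoid_scheme \<Rightarrow> 'a topology \<Rightarrow> bool"
  where "profinite_group G X \<longleftrightarrow>
    topological_group G X \<and> compact_space X \<and> Hausdorff_space X \<and> totally_disconnected X"

text \<open>The vertices of the \<open>m\<close>-adic rooted tree; the empty word is the root.\<close>

definition tree_words :: "nat \<Rightarrow> nat list set"
  where "tree_words m = lists {1..m}"

definition tree_level :: "nat \<Rightarrow> nat \<Rightarrow> nat list set"
  where "tree_level m n = {v \<in> tree_words m. length v = n}"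

definition tree_adj :: "nat list \<Rightarrow> nat list \<Rightarrow> bool"
  where "tree_adj u v \<longleftrightarrow> (\<exists>x. v = u @ [x]) \<or> (\<exists>x. u = v @ [x])"

text \<open>
  Automorphisms act on the right, so the product of \<open>g\<close> and \<open>h\<close> is ``first \<open>g\<close>, then \<open>h\<close>''.
  They are total functions on lists; \<open>permutes\<close> makes them the identity off the tree, so that
  equality of automorphisms is equality of functions.
\<close>

definition AutT :: "nat \<Rightarrow> (nat list \<Rightarrow> nat list) monoid"
  where "AutT m =
    \<lparr>carrier = {g. g permutes tree_words m \<and> g [] = [] \<and>
        (\<forall>u \<in> tree_words m. \<forall>v \<in> tree_words m. tree_adj (g u) (g v) \<longleftrightarrow> tree_adj u v)},
     mult = (\<lambda>g h. h \<circ> g),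
     one = id\<rparr>"

text \<open>
  The section of \<open>g\<close> at \<open>v\<close>. The lemmas \<open>section_at_append\<close>, \<open>section_at_closed\<close> and
  \<open>section_at_unique\<close> below show that it is the automorphism determined by
  \<open>g (v @ u) = g v @ section_at m g v u\<close>.
\<close>

definition section_at :: "nat \<Rightarrow> (nat list \<Rightarrow> nat list) \<Rightarrow> nat list \<Rightarrow> nat list \<Rightarrow> nat list"
  where "section_at m g v =
    (\<lambda>u. if u \<in> tree_words m then drop (length v) (g (v @ u)) else u)"

definition level_stabilizer ::
    "nat \<Rightarrow> (nat list \<Rightarrow> nat list) set \<Rightarrow> nat \<Rightarrow> (nat list \<Rightarrow> nat list) set"
  where "level_stabilizer m K n = {g \<in> K. \<forall>v \<in> tree_level m n. g v = v}"

definition level_transitive :: "nat \<Rightarrow> (nat list \<Rightarrow> nat list) set \<Rightarrow> bool"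
  where "level_transitive m K \<longleftrightarrow>
    (\<forall>n. \<forall>u \<in> tree_level m n. \<forall>v \<in> tree_level m n. \<exists>g \<in> K. g u = v)"

definition self_similar :: "nat \<Rightarrow> (nat list \<Rightarrow> nat list) set \<Rightarrow> bool"
  where "self_similar m K \<longleftrightarrow> (\<forall>g \<in> K. \<forall>v \<in> tree_words m. section_at m g v \<in> K)"

definition AutT_topology :: "nat \<Rightarrow> (nat list \<Rightarrow> nat list) topology"
  where "AutT_topology m = topology (\<lambda>U. U \<subseteq> carrier (AutT m) \<and>
    (\<forall>g \<in> U. \<exists>n. g <#\<^bsub>AutT m\<^esub> level_stabilizer m (carrier (AutT m)) n \<subseteq> U))"

text \<open>
  The index \<open>|K : St\<^sub>K(n)|\<close>; it is finite for every subgroup \<open>K\<close>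
  (lemma \<open>finite_level_cosets\<close>), so \<open>card\<close> is its true value.
\<close>

definition level_index :: "nat \<Rightarrow> (nat list \<Rightarrow> nat list) set \<Rightarrow> nat \<Rightarrow> nat"
  where "level_index m K n =
    card (rcosets\<^bsub>(AutT m)\<lparr>carrier := K\<rparr>\<^esub> (level_stabilizer m K n))"

definition hdim :: "nat \<Rightarrow> (nat list \<Rightarrow> nat list) set \<Rightarrow> ereal"
  where "hdim m K = liminf (\<lambda>n.
    ereal (ln (real (level_index m K n)) / ln (real (level_index m (carrier (AutT m)) n))))"


lemma tree_words_simps [simp]:
  "[] \<in> tree_words m"
  "u @ v \<in> tree_words m \<longleftrightarrow> u \<in> tree_words m \<and> v \<in> tree_words m"
  "x # u \<in> tree_words m \<longleftrightarrow> x \<in> {1..m} \<and> u \<in> tree_words m"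
  by (auto simp: tree_words_def)

lemma AutT_simps [simp]: "g \<otimes>\<^bsub>AutT m\<^esub> h = h \<circ> g" "\<one>\<^bsub>AutT m\<^esub> = id"
  by (auto simp: AutT_def)

lemma AutT_permutes: "g \<in> carrier (AutT m) \<Longrightarrow> g permutes tree_words m"
  by (simp add: AutT_def)

lemma AutT_root: "g \<in> carrier (AutT m) \<Longrightarrow> g [] = []"
  by (simp add: AutT_def)

lemma AutT_adj:
  "g \<in> carrier (AutT m) \<Longrightarrow> u \<in> tree_words m \<Longrightarrow> v \<in> tree_words m \<Longrightarrow>
    tree_adj (g u) (g v) \<longleftrightarrow> tree_adj u v"
  by (simp add: AutT_def)

lemma AutT_in_words [simp]:
  "g \<in> carrier (AutT m) \<Longrightarrow> g v \<in> tree_words m \<longleftrightarrow> v \<in> tree_words m"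
  by (metis AutT_permutes permutes_in_image)

lemma AutT_inj: "g \<in> carrier (AutT m) \<Longrightarrow> g u = g v \<longleftrightarrow> u = v"
  by (metis AutT_permutes permutes_inj injD)

lemma group_AutT: "group (AutT m)"
proof (rule groupI)
  fix g assume g: "g \<in> carrier (AutT m)"
  let ?h = "Hilbert_Choice.inv g"
  have p: "?h permutes tree_words m"
    using AutT_permutes[OF g] permutes_inv by blast
  have gh: "g (?h v) = v" for v
    using AutT_permutes[OF g] permutes_inverses(1) by metis
  have hg: "?h (g v) = v" for v
    using AutT_permutes[OF g] permutes_inverses(2) by metis
  have adj: "tree_adj (?h u) (?h v) \<longleftrightarrow> tree_adj u v"
    if "u \<in> tree_words m" "v \<in> tree_words m" for u v
    using AutT_adj[OF g, of "?h u" "?h v"] that gh p by (simp add: permutes_in_image)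
  have "?h [] = []" using hg[of "[]"] AutT_root[OF g] by simp
  then have "?h \<in> carrier (AutT m)"
    using p adj by (simp add: AutT_def)
  moreover have "?h \<otimes>\<^bsub>AutT m\<^esub> g = \<one>\<^bsub>AutT m\<^esub>"
    using gh by auto
  ultimately show "\<exists>y\<in>carrier (AutT m). y \<otimes>\<^bsub>AutT m\<^esub> g = \<one>\<^bsub>AutT m\<^esub>" by blast
next
  fix g h assume g: "g \<in> carrier (AutT m)" and h: "h \<in> carrier (AutT m)"
  have "h \<circ> g permutes tree_words m"
    using g h AutT_permutes permutes_compose by blast
  with g h show "g \<otimes>\<^bsub>AutT m\<^esub> h \<in> carrier (AutT m)"
    by (simp add: AutT_def permutes_in_image)
qed (auto simp: AutT_def permutes_id o_assoc)

lemma AutT_child: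
  assumes g: "g \<in> carrier (AutT m)"
  shows "v @ [x] \<in> tree_words m \<Longrightarrow> \<exists>y. g (v @ [x]) = g v @ [y]"
proof (induction v arbitrary: x rule: rev_induct)
  case Nil
  have "tree_adj (g []) (g [x])" using AutT_adj[OF g, of "[]" "[x]"] Nil
    by (simp add: tree_adj_def)
  then show ?case using AutT_root[OF g] by (simp add: tree_adj_def)
next
  case (snoc z v)
  from snoc.prems have w: "v @ [z] \<in> tree_words m" by simp
  from snoc.IH[OF w] obtain y where y: "g (v @ [z]) = g v @ [y]" by blast
  have "tree_adj (g (v @ [z])) (g ((v @ [z]) @ [x]))"
    using AutT_adj[OF g w snoc.prems] by (auto simp: tree_adj_def)
  moreover have "g v \<noteq> g ((v @ [z]) @ [x])" by (simp add: AutT_inj[OF g])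
  ultimately show ?case using y by (auto simp: tree_adj_def)
qed

lemma AutT_append:
  assumes g: "g \<in> carrier (AutT m)"
  shows "v @ u \<in> tree_words m \<Longrightarrow> \<exists>w. g (v @ u) = g v @ w \<and> length w = length u"
proof (induction u rule: rev_induct)
  case (snoc x u)
  then obtain w where "g (v @ u) = g v @ w" "length w = length u" by auto
  moreover obtain y where "g ((v @ u) @ [x]) = g (v @ u) @ [y]"
    using AutT_child[OF g, of "v @ u" x] snoc.prems by auto
  ultimately show ?case by simp
qed simp

lemma AutT_length:
  assumes "g \<in> carrier (AutT m)"
  shows "length (g v) = length v"
proof (cases "v \<in> tree_words m")
  case True
  then show ?thesis using AutT_append[OF assms, of "[]" v] AutT_root[OF assms] by auto
next
  case False
  then show ?thesis using AutT_permutes[OF assms] by (simp add: permutes_not_in)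
qed

lemma section_at_append:
  assumes "g \<in> carrier (AutT m)" "v \<in> tree_words m" "u \<in> tree_words m"
  shows "g (v @ u) = g v @ section_at m g v u"
  using AutT_append[OF assms(1), of v u] assms AutT_length[OF assms(1), of v]
  by (auto simp: section_at_def)

lemma section_at_closed:
  assumes g: "g \<in> carrier (AutT m)" and v: "v \<in> tree_words m"
  shows "section_at m g v \<in> carrier (AutT m)"
proof -
  let ?s = "section_at m g v"
  note app = section_at_append[OF g v]
  have cl: "?s u \<in> tree_words m" if "u \<in> tree_words m" for u
    using app[OF that] AutT_in_words[OF g, of "v @ u"] v that by simp
  have "bij_betw ?s (tree_words m) (tree_words m)"
  proof (rule bij_betw_imageI)
    show "inj_on ?s (tree_words m)"
      by (rule inj_onI) (metis AutT_inj[OF g] app same_append_eq)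
    have "w \<in> ?s ` tree_words m" if w: "w \<in> tree_words m" for w
    proof -
      obtain z where z: "g z = g v @ w"
        using AutT_permutes[OF g] permutes_surj by (metis surjD)
      then have zw: "z \<in> tree_words m"
        using AutT_in_words[OF g, of z] AutT_in_words[OF g, of v] v w by simp
      define p where "p = take (length v) z"
      define q where "q = drop (length v) z"
      have pq: "z = p @ q" by (simp add: p_def q_def)
      have "length z = length v + length w"
        using z AutT_length[OF g] by (metis length_append)
      then have "length p = length v" by (simp add: p_def)
      moreover obtain w' where "g (p @ q) = g p @ w'"
        using AutT_append[OF g, of p q] zw pq by auto
      ultimately have "g p = g v"
        using z pq AutT_length[OF g] by (metis append_eq_append_conv)
      then have "p = v" using AutT_inj[OF g] by blast
      then have "w = ?s q" "q \<in> tree_words m"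
        using z pq app[of q] zw by auto
      then show ?thesis by blast
    qed
    then show "?s ` tree_words m = tree_words m" using cl by auto
  qed
  then have "?s permutes tree_words m"
    by (rule bij_imp_permutes) (simp add: section_at_def)
  moreover have "?s [] = []"
    using app[of "[]"] by simp
  moreover have "tree_adj (?s u) (?s w) \<longleftrightarrow> tree_adj u w"
    if "u \<in> tree_words m" "w \<in> tree_words m" for u w
    using AutT_adj[OF g, of "v @ u" "v @ w"] app that v by (simp add: tree_adj_def)
  ultimately show ?thesis by (simp add: AutT_def)
qed

lemma section_at_unique:
  assumes "g \<in> carrier (AutT m)" "v \<in> tree_words m" "h \<in> carrier (AutT m)"
    and "\<And>u. u \<in> tree_words m \<Longrightarrow> g (v @ u) = g v @ h u"
  shows "h = section_at m g v"
proof
  fix u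
  show "h u = section_at m g v u"
  proof (cases "u \<in> tree_words m")
    case True
    then show ?thesis using assms(4) section_at_append[OF assms(1,2)] by (metis same_append_eq)
  next
    case False
    then show ?thesis
      using AutT_permutes[OF assms(3)] by (simp add: section_at_def permutes_not_in)
  qed
qed

lemma AutT_l_coset:
  assumes g: "g \<in> carrier (AutT m)"
  shows "g <#\<^bsub>AutT m\<^esub> level_stabilizer m (carrier (AutT m)) n =
    {h \<in> carrier (AutT m). \<forall>v \<in> tree_level m n. h v = g v}" (is "?L = ?R")
proof
  interpret group "AutT m" by (rule group_AutT)
  have lev: "g v \<in> tree_level m n" if "v \<in> tree_level m n" for v
    using that AutT_length[OF g] g by (simp add: tree_level_def)
  show "?L \<subseteq> ?R"
    using lev m_closed[OF g] by (auto simp: l_coset_def level_stabilizer_def)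
  show "?R \<subseteq> ?L"
  proof
    fix h assume h: "h \<in> ?R"
    let ?i = "inv\<^bsub>AutT m\<^esub> g"
    let ?s = "?i \<otimes>\<^bsub>AutT m\<^esub> h"
    have i: "?i \<in> carrier (AutT m)" using g by simp
    have gi: "g (?i v) = v" for v using l_inv[OF g] by (simp add: fun_eq_iff)
    have "?s v = v" if "v \<in> tree_level m n" for v
    proof -
      have "?i v \<in> tree_level m n"
        using that AutT_length[OF i] i by (simp add: tree_level_def)
      then show ?thesis using h gi by simp
    qed
    moreover have "?s \<in> carrier (AutT m)" using i h m_closed by blast
    moreover have "h = g \<otimes>\<^bsub>AutT m\<^esub> ?s"
      using g h i by (metis (no_types, lifting) inv_solve_left m_closed mem_Collect_eq)
    ultimately show "h \<in> ?L"
      unfolding l_coset_def level_stabilizer_def by blast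
  qed
qed

lemma level_agree_mono:
  assumes "n \<le> n'" "m \<ge> 1" "g \<in> carrier (AutT m)" "h \<in> carrier (AutT m)"
    and "\<forall>v \<in> tree_level m n'. h v = g v"
  shows "\<forall>v \<in> tree_level m n. h v = g v"
proof
  fix v assume v: "v \<in> tree_level m n"
  define u where "u = replicate (n' - n) (1::nat)"
  have u: "u \<in> tree_words m" using assms(2) by (auto simp: u_def tree_words_def)
  then have "v @ u \<in> tree_level m n'"
    using v assms(1) by (simp add: tree_level_def u_def)
  then have "h (v @ u) = g (v @ u)" using assms(5) by blast
  then show "h v = g v"
    using section_at_append[OF assms(3) _ u] section_at_append[OF assms(4) _ u] v
      AutT_length[OF assms(3), of v] AutT_length[OF assms(4), of v]
    by (simp add: tree_level_def)
qed

lemma openin_AutT_topology: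
  assumes m: "m \<ge> 1"
  shows "openin (AutT_topology m) U \<longleftrightarrow> U \<subseteq> carrier (AutT m) \<and>
    (\<forall>g \<in> U. \<exists>n. g <#\<^bsub>AutT m\<^esub> level_stabilizer m (carrier (AutT m)) n \<subseteq> U)"
proof -
  let ?B = "\<lambda>g n. g <#\<^bsub>AutT m\<^esub> level_stabilizer m (carrier (AutT m)) n"
  have mono: "?B g n' \<subseteq> ?B g n" if "g \<in> carrier (AutT m)" "n \<le> n'" for g n n'
    unfolding AutT_l_coset[OF that(1)]
  proof
    fix h assume h: "h \<in> {h \<in> carrier (AutT m). \<forall>v \<in> tree_level m n'. h v = g v}"
    then have "\<forall>v \<in> tree_level m n. h v = g v"
      by (intro level_agree_mono[OF that(2) m that(1)]) simp_all
    with h show "h \<in> {h \<in> carrier (AutT m). \<forall>v \<in> tree_level m n. h v = g v}" by simp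
  qed
  have "istopology (\<lambda>U. U \<subseteq> carrier (AutT m) \<and> (\<forall>g \<in> U. \<exists>n. ?B g n \<subseteq> U))"
    unfolding istopology_def
  proof (intro conjI allI impI ballI)
    fix S T g
    assume S: "S \<subseteq> carrier (AutT m) \<and> (\<forall>g\<in>S. \<exists>n. ?B g n \<subseteq> S)"
      and T: "T \<subseteq> carrier (AutT m) \<and> (\<forall>g\<in>T. \<exists>n. ?B g n \<subseteq> T)"
      and g: "g \<in> S \<inter> T"
    then obtain a b where ab: "?B g a \<subseteq> S" "?B g b \<subseteq> T" by blast
    have "g \<in> carrier (AutT m)" using S g by blast
    then have "?B g (max a b) \<subseteq> ?B g a" "?B g (max a b) \<subseteq> ?B g b"
      by (simp_all only: mono max.cobounded1 max.cobounded2)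
    then show "\<exists>n. ?B g n \<subseteq> S \<inter> T" using ab by blast
  next
    fix \<K> g
    assume K: "\<forall>K\<in>\<K>. K \<subseteq> carrier (AutT m) \<and> (\<forall>g\<in>K. \<exists>n. ?B g n \<subseteq> K)" and "g \<in> \<Union>\<K>"
    then obtain K n where "K \<in> \<K>" "?B g n \<subseteq> K" by blast
    then show "\<exists>n. ?B g n \<subseteq> \<Union>\<K>" by blast
  qed blast+
  then show ?thesis by (simp add: AutT_topology_def)
qed

lemma finite_level_cosets:
  assumes K: "subgroup K (AutT m)"
  shows "finite (rcosets\<^bsub>(AutT m)\<lparr>carrier := K\<rparr>\<^esub> (level_stabilizer m K n))"
proof -
  interpret group "AutT m" by (rule group_AutT)
  let ?G = "(AutT m)\<lparr>carrier := K\<rparr>"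
  let ?L = "tree_level m n"
  have sub: "K \<subseteq> carrier (AutT m)" using K by (rule subgroup.subset)
  have coset: "level_stabilizer m K n #>\<^bsub>?G\<^esub> k = {g \<in> K. restrict g ?L = restrict k ?L}"
    if k: "k \<in> K" for k
  proof
    have kc: "k \<in> carrier (AutT m)" using k sub by blast
    show "level_stabilizer m K n #>\<^bsub>?G\<^esub> k \<subseteq> {g \<in> K. restrict g ?L = restrict k ?L}"
    proof
      fix g assume "g \<in> level_stabilizer m K n #>\<^bsub>?G\<^esub> k"
      then obtain s where s: "s \<in> K" "\<forall>v \<in> ?L. s v = v" and g: "g = s \<otimes>\<^bsub>AutT m\<^esub> k"
        unfolding r_coset_def level_stabilizer_def by auto
      have "g \<in> K" using subgroup.m_closed[OF K s(1) k] g by simp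
      moreover have "restrict g ?L = restrict k ?L"
        using s(2) g by (intro restrict_ext) simp
      ultimately show "g \<in> {g \<in> K. restrict g ?L = restrict k ?L}" by simp
    qed
    show "{g \<in> K. restrict g ?L = restrict k ?L} \<subseteq> level_stabilizer m K n #>\<^bsub>?G\<^esub> k"
    proof
      fix g assume g: "g \<in> {g \<in> K. restrict g ?L = restrict k ?L}"
      let ?i = "inv\<^bsub>AutT m\<^esub> k"
      let ?s = "g \<otimes>\<^bsub>AutT m\<^esub> ?i"
      have "g \<in> K" using g by simp
      then have "?s \<in> K"
        by (rule subgroup.m_closed[OF K _ subgroup.m_inv_closed[OF K k]])
      moreover have "?s v = v" if "v \<in> ?L" for v
      proof -
        have "restrict g ?L v = restrict k ?L v" using g by simp
        then have "g v = k v" using that by simp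
        moreover have "?i (k v) = v" using r_inv[OF kc] by (simp add: fun_eq_iff)
        ultimately show ?thesis by simp
      qed
      moreover have "g = ?s \<otimes>\<^bsub>AutT m\<^esub> k"
        using l_inv[OF kc] by (simp add: fun_eq_iff)
      ultimately have "g = ?s \<otimes>\<^bsub>?G\<^esub> k" "?s \<in> level_stabilizer m K n"
        by (simp_all only: monoid.simps partial_object.update_convs level_stabilizer_def) auto
      then show "g \<in> level_stabilizer m K n #>\<^bsub>?G\<^esub> k"
        unfolding r_coset_def by blast
    qed
  qed
  have fin: "finite ?L"
    using finite_lists_length_eq[of "{1..m}" n]
    by (simp add: tree_level_def tree_words_def lists_eq_set conj_commute)
  have "restrict k ?L \<in> ?L \<rightarrow>\<^sub>E ?L" if "k \<in> K" for k
  proof -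
    have "k \<in> carrier (AutT m)" using that sub by blast
    then show ?thesis using AutT_length by (auto simp: tree_level_def)
  qed
  then have "(\<lambda>k. restrict k ?L) ` K \<subseteq> ?L \<rightarrow>\<^sub>E ?L" by blast
  then have "finite ((\<lambda>k. restrict k ?L) ` K)"
    using fin by (meson finite_PiE finite_subset)
  moreover have "rcosets\<^bsub>?G\<^esub> (level_stabilizer m K n) \<subseteq>
      (\<lambda>f. {g \<in> K. restrict g ?L = f}) ` (\<lambda>k. restrict k ?L) ` K"
    using coset by (auto simp: RCOSETS_def)
  ultimately show ?thesis by (meson finite_imageI finite_subset)
qed

end

theory Submission
  imports Defs
begin

text \<open>
  Let \<open>K\<close> be the image of the action and let \<open>z \<noteq> 1\<close> be central in \<open>K\<close>, say \<open>z v \<noteq> v\<close> with \<open>v\<close>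
  on level \<open>n\<close>. Since \<open>k\<close> commutes with \<open>z\<close>, the section of \<open>k \<in> K\<close> at \<open>z v\<close> is determined by \<open>z\<close>,
  the action of \<open>k\<close> on level \<open>n\<close> and its section at \<open>v\<close>. Hence \<open>k\<close> is determined by its action on
  level \<open>n\<close> and its sections at the remaining \<open>r = m ^ n - 1\<close> vertices, which lie in \<open>K\<close> by
  self-similarity: \<open>|K : St(n + l)| \<le> |K : St(n)| |K : St(l)| ^ r\<close>. So \<open>log |K : St(j n)|\<close> grows at
  most like \<open>j r ^ j\<close>, whereas \<open>log |Aut T : St(j n)|\<close> is at least of order \<open>m ^ (j n)\<close>.
\<close>

section \<open>Level sizes, and indices as numbers of induced level actions\<close>

lemma finite_tree_level: "finite (tree_level m n)"
  and card_tree_level: "card (tree_level m n) = m ^ n"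
proof -
  have eq: "tree_level m n = {xs. set xs \<subseteq> {1..m} \<and> length xs = n}"
    by (auto simp: tree_level_def tree_words_def lists_eq_set)
  show "finite (tree_level m n)"
    unfolding eq by (rule finite_lists_length_eq) simp
  show "card (tree_level m n) = m ^ n"
    unfolding eq by (subst card_lists_length_eq) simp_all
qed

lemma AutT_tree_level [simp]:
  "g \<in> carrier (AutT m) \<Longrightarrow> g v \<in> tree_level m n \<longleftrightarrow> v \<in> tree_level m n"
  by (simp add: tree_level_def AutT_length)

text \<open>A concrete model of the quotient of \<open>K\<close> by its level stabilizer.
  Restrictions are extensional, so equal actions on the level are equal functions and can be
  counted.\<close>

definition level_actions ::
    "nat \<Rightarrow> (nat list \<Rightarrow> nat list) set \<Rightarrow> nat \<Rightarrow> (nat list \<Rightarrow> nat list) set"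
  where "level_actions m K n = (\<lambda>k. restrict k (tree_level m n)) ` K"

lemma restrict_eq_iff: "restrict f A = restrict g A \<longleftrightarrow> (\<forall>x\<in>A. f x = g x)"
  by (metis restrict_apply' restrict_ext)

lemma finite_level_actions:
  assumes "K \<subseteq> carrier (AutT m)"
  shows "finite (level_actions m K n)"
proof -
  have "level_actions m K n \<subseteq> tree_level m n \<rightarrow>\<^sub>E tree_level m n"
    using assms by (auto simp: level_actions_def)
  then show ?thesis
    using finite_tree_level by (meson finite_PiE finite_subset)
qed

lemma level_stabilizer_r_coset:
  assumes K: "subgroup K (AutT m)" and k: "k \<in> K"
  shows "level_stabilizer m K n #>\<^bsub>(AutT m)\<lparr>carrier := K\<rparr>\<^esub> k =
    {g \<in> K. restrict g (tree_level m n) = restrict k (tree_level m n)}" (is "?L = ?R")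
proof
  interpret group "AutT m" by (rule group_AutT)
  have kc: "k \<in> carrier (AutT m)" using k subgroup.subset[OF K] by blast
  show "?L \<subseteq> ?R"
  proof
    fix g assume "g \<in> ?L"
    then obtain s where s: "s \<in> K" "\<forall>v \<in> tree_level m n. s v = v" and g: "g = k \<circ> s"
      unfolding r_coset_def level_stabilizer_def by auto
    then show "g \<in> ?R"
      using subgroup.m_closed[OF K s(1) k] by (simp add: restrict_eq_iff)
  qed
  show "?R \<subseteq> ?L"
  proof
    fix g assume g: "g \<in> ?R"
    \<comment> \<open>The product is reversed composition, so the stabilizer element with
      \<open>g\<close> = element times \<open>k\<close> is \<open>?i \<circ> g\<close>: first
      \<open>g\<close>, then the inverse.\<close>
    let ?i = "inv\<^bsub>AutT m\<^esub> k"
    have "?i \<circ> g \<in> K"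
      using subgroup.m_closed[OF K _ subgroup.m_inv_closed[OF K k], of g] g by simp
    moreover have "?i (k v) = v" for v
      using r_inv[OF kc] by (simp add: fun_eq_iff)
    then have "\<forall>v \<in> tree_level m n. (?i \<circ> g) v = v"
      using g by (simp add: restrict_eq_iff)
    moreover have "g = k \<circ> (?i \<circ> g)"
      using l_inv[OF kc] by (simp add: fun_eq_iff)
    ultimately show "g \<in> ?L"
      unfolding r_coset_def level_stabilizer_def by auto
  qed
qed

text \<open>Right cosets of the stabilizer are the fibres of restriction to the level, so each coset
  corresponds to exactly one induced action.\<close>

lemma level_index_eq_card:
  assumes K: "subgroup K (AutT m)"
  shows "level_index m K n = card (level_actions m K n)"
proof -
  let ?F = "\<lambda>f. {g \<in> K. restrict g (tree_level m n) = f}"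
  have "rcosets\<^bsub>(AutT m)\<lparr>carrier := K\<rparr>\<^esub> (level_stabilizer m K n) = ?F ` level_actions m K n"
    unfolding RCOSETS_def level_actions_def
    using level_stabilizer_r_coset[OF K] by auto
  moreover have "inj_on ?F (level_actions m K n)"
    by (rule inj_onI) (auto simp: level_actions_def)
  ultimately show ?thesis
    by (simp add: level_index_def card_image)
qed

section \<open>Recursive bound on the index from a commuting automorphism\<close>

lemma card_image_le_if_determined:
  assumes fin: "finite (g ` A)" and "\<And>x y. x \<in> A \<Longrightarrow> y \<in> A \<Longrightarrow> g x = g y \<Longrightarrow> f x = f y"
  shows "card (f ` A) \<le> card (g ` A)"
proof (rule surj_card_le[OF fin])
  show "f ` A \<subseteq> (\<lambda>y. f (inv_into A g y)) ` g ` A"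
  proof
    fix y assume "y \<in> f ` A"
    then obtain x where x: "x \<in> A" "y = f x" by blast
    then have "f (inv_into A g (g x)) = f x"
      by (intro assms(2)) (auto simp: inv_into_into f_inv_into_f)
    then show "y \<in> (\<lambda>y. f (inv_into A g y)) ` g ` A"
      using x by force
  qed
qed

text \<open>From \<open>k (z (v @ q)) = z (k (v @ q))\<close>, the action of \<open>k\<close> below
  \<open>z v\<close> can be read off from its action below \<open>v\<close>. One of the
  \<open>m ^ n\<close> sections is therefore redundant, whence the exponent
  \<open>m ^ n - 1\<close>.\<close>

lemma card_level_actions_add_le:
  assumes sub: "K \<subseteq> carrier (AutT m)" and ss: "self_similar m K"
    and z: "z \<in> carrier (AutT m)" and comm: "\<And>k. k \<in> K \<Longrightarrow> k \<circ> z = z \<circ> k"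
    and v: "v \<in> tree_level m n" and moved: "z v \<noteq> v"
  shows "card (level_actions m K (n + l)) \<le>
    card (level_actions m K n) * card (level_actions m K l) ^ (m ^ n - 1)"
proof -
  define R where "R = tree_level m n - {z v}"
  define \<Phi> where "\<Phi> = (\<lambda>k. (restrict k (tree_level m n),
    restrict (\<lambda>p. restrict (section_at m k p) (tree_level m l)) R))"
  define P where "P = level_actions m K n \<times> (R \<rightarrow>\<^sub>E level_actions m K l)"
  have zv: "z v \<in> tree_level m n" using v z by simp
  have R_level: "p \<in> tree_level m n" if "p \<in> R" for p
    using that by (simp add: R_def)
  have finR: "finite R" by (simp add: R_def finite_tree_level)
  have cardR: "card R = m ^ n - 1"
    using zv by (simp add: R_def card_tree_level)
  have finP: "finite P"
    unfolding P_def using finite_level_actions[OF sub] finR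
    by (intro finite_cartesian_product finite_PiE)
  have "section_at m k p \<in> K" if "k \<in> K" "p \<in> R" for k p
    using ss that R_level[of p] by (simp add: self_similar_def tree_level_def)
  then have \<Phi>P: "\<Phi> ` K \<subseteq> P"
    unfolding \<Phi>_def P_def level_actions_def 
    by (intro image_subsetI SigmaI restrict_PiE_iff[THEN iffD2] ballI imageI)
  have at_R: "k (p @ q) = k' (p @ q)"
    if k: "k \<in> K" "k' \<in> K" "\<Phi> k = \<Phi> k'" and p: "p \<in> R" and q: "q \<in> tree_level m l" for k k' p q
  proof -
    have kc: "k \<in> carrier (AutT m)" "k' \<in> carrier (AutT m)" using k sub by auto
    have pq: "p \<in> tree_words m" "q \<in> tree_words m" and p': "p \<in> tree_level m n"
      using R_level[OF p] q by (auto simp: tree_level_def)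
    have "k p = k' p"
      using k(3) p' by (simp add: \<Phi>_def restrict_eq_iff)
    moreover have "restrict (section_at m k p) (tree_level m l) =
        restrict (section_at m k' p) (tree_level m l)"
      using k(3) p unfolding \<Phi>_def prod.inject restrict_eq_iff[of _ R] by blast
    then have "section_at m k p q = section_at m k' p q"
      using q by (simp add: restrict_eq_iff)
    ultimately show ?thesis
      using section_at_append[OF kc(1) pq] section_at_append[OF kc(2) pq] by simp
  qed
  have "restrict k (tree_level m (n + l)) = restrict k' (tree_level m (n + l))"
    if k: "k \<in> K" "k' \<in> K" "\<Phi> k = \<Phi> k'" for k k'
    unfolding restrict_eq_iff
  proof
    fix x assume x: "x \<in> tree_level m (n + l)"
    define p q where "p = take n x" and "q = drop n x"
    have xpq: "x = p @ q" by (simp add: p_def q_def)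
    have "p @ q \<in> tree_words m" "length x = n + l"
      using x by (simp_all add: tree_level_def flip: xpq)
    then have pq: "p \<in> tree_level m n" "q \<in> tree_level m l"
      by (simp_all add: tree_level_def) (simp_all add: p_def q_def)
    show "k x = k' x"
    proof (cases "p = z v")
      case False
      then show ?thesis using at_R[OF k] pq by (simp add: xpq R_def)
    next
      case True
      have vw: "v \<in> tree_words m" using v by (simp add: tree_level_def)
      have s: "section_at m z v \<in> carrier (AutT m)"
        by (rule section_at_closed[OF z vw])
      \<comment> \<open>Sections are bijective, so every word below \<open>z v\<close> is the image
        under \<open>z\<close> of a word below \<open>v\<close>.\<close>
      obtain q' where q': "section_at m z v q' = q"
        using AutT_permutes[OF s] permutes_surj by (metis surjD)
      then have q'l: "q' \<in> tree_level m l"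
        using pq(2) s by (metis AutT_tree_level)
      then have "z (v @ q') = x"
        using section_at_append[OF z vw, of q'] q' True by (simp add: xpq tree_level_def)
      \<comment> \<open>Because \<open>z\<close> moves \<open>v\<close>, the vertex \<open>v\<close>
        itself was not discarded and its section is recorded in \<open>\<Phi>\<close>.\<close>
      moreover have "v \<in> R" using v moved by (simp add: R_def)
      then have "k (v @ q') = k' (v @ q')" using at_R[OF k] q'l by blast
      ultimately show ?thesis
        using comm[OF k(1)] comm[OF k(2)] by (metis comp_apply)
    qed
  qed
  then have "card (level_actions m K (n + l)) \<le> card (\<Phi> ` K)"
    unfolding level_actions_def
    by (intro card_image_le_if_determined finite_subset[OF \<Phi>P finP])
  also have "\<dots> \<le> card P"
    by (rule card_mono[OF finP \<Phi>P])
  also have "\<dots> = card (level_actions m K n) * card (level_actions m K l) ^ (m ^ n - 1)"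
    by (simp add: P_def card_cartesian_product card_PiE finR cardR)
  finally show ?thesis .
qed

section \<open>Lower bound for the index in the full automorphism group\<close>

text \<open>Independent switches at the vertices of level \<open>n\<close>, one for each element of
  \<open>S\<close>. Indices start at 0, so \<open>v ! n\<close> is the letter directly after the
  prefix tested against \<open>S\<close>.\<close>

definition swap_below :: "nat \<Rightarrow> nat \<Rightarrow> nat list set \<Rightarrow> nat list \<Rightarrow> nat list"
  where "swap_below m n S = (\<lambda>v. if v \<in> tree_words m \<and> n < length v \<and> take n v \<in> S
    then v[n := Transposition.transpose 1 2 (v ! n)] else v)"

lemma length_swap_below [simp]: "length (swap_below m n S v) = length v"
  by (simp add: swap_below_def)

lemma swap_below_in_words:
  assumes "m \<ge> 2" "v \<in> tree_words m"
  shows "swap_below m n S v \<in> tree_words m"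
proof -
  have "v[n := Transposition.transpose 1 2 (v ! n)] \<in> tree_words m" if "n < length v"
  proof -
    have "v ! n \<in> {1..m}"
      using assms(2) nth_mem[OF that] unfolding tree_words_def lists_eq_set by blast
    then have "Transposition.transpose 1 2 (v ! n) \<in> {1..m}"
      using assms(1) by (auto simp: Transposition.transpose_def)
    moreover have "set (v[n := Transposition.transpose 1 2 (v ! n)]) \<subseteq> insert (Transposition.transpose 1 2 (v ! n)) (set v)"
      by (rule set_update_subset_insert)
    ultimately show ?thesis
      using assms(2) by (auto simp: tree_words_def lists_eq_set)
  qed
  then show ?thesis using assms(2) by (simp add: swap_below_def)
qed

text \<open>A switch changes neither the length nor the prefix of length \<open>n\<close>, so the
  same condition triggers it again and the transposition cancels.\<close>

lemma swap_below_involution: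
  assumes "m \<ge> 2"
  shows "swap_below m n S (swap_below m n S v) = v"
proof (cases "v \<in> tree_words m \<and> n < length v \<and> take n v \<in> S")
  case True
  then have "swap_below m n S v = v[n := Transposition.transpose 1 2 (v ! n)]"
    by (simp add: swap_below_def)
  with True swap_below_in_words[OF assms, of v n S] show ?thesis
    by (simp add: swap_below_def)
qed (auto simp: swap_below_def)

lemma swap_below_child:
  assumes "v @ [x] \<in> tree_words m"
  shows "\<exists>y. swap_below m n S (v @ [x]) = swap_below m n S v @ [y]"
proof -
  consider "n < length v" | "n = length v" | "n > length v" by linarith
  then show ?thesis
    using assms by cases (auto simp: swap_below_def list_update_append nth_append)
qed

lemma swap_below_in_AutT:
  assumes m: "m \<ge> 2"
  shows "swap_below m n S \<in> carrier (AutT m)"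
proof -
  let ?g = "swap_below m n S"
  have "bij_betw ?g (tree_words m) (tree_words m)"
    by (rule bij_betw_byWitness[where f' = ?g])
      (auto simp: swap_below_involution[OF m] swap_below_in_words[OF m])
  then have "?g permutes tree_words m"
    by (rule bij_imp_permutes) (simp add: swap_below_def)
  moreover have "?g [] = []" by (simp add: swap_below_def)
  moreover have adj: "tree_adj (?g u) (?g v)"
    if "u \<in> tree_words m" "v \<in> tree_words m" "tree_adj u v" for u v
    using that swap_below_child[of _ _ m n S] unfolding tree_adj_def by metis
  \<comment> \<open>The map is its own inverse, so preservation of adjacency also gives its
    reflection.\<close>
  moreover have "tree_adj u v"
    if "u \<in> tree_words m" "v \<in> tree_words m" "tree_adj (?g u) (?g v)" for u v
    using adj[of "?g u" "?g v"] that
    by (simp add: swap_below_in_words[OF m] swap_below_involution[OF m])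
  ultimately show ?thesis unfolding AutT_def partial_object.simps by blast
qed

text \<open>The set \<open>S\<close> is recovered from its switch by testing which words
  \<open>v @ [1]\<close> are moved, so distinct subsets of level \<open>n\<close> act differently
  one level further down.\<close>

lemma card_level_actions_AutT_ge:
  assumes m: "m \<ge> 2"
  shows "2 ^ (m ^ n) \<le> card (level_actions m (carrier (AutT m)) (Suc n))"
proof -
  let ?f = "\<lambda>S. restrict (swap_below m n S) (tree_level m (Suc n))"
  have mem: "v \<in> S \<longleftrightarrow> ?f S (v @ [1]) \<noteq> v @ [1]" if "v \<in> tree_level m n" for v S
    using that m by (auto simp: tree_level_def swap_below_def list_update_append nth_append)
  have "inj_on ?f (Pow (tree_level m n))"
  proof (rule inj_onI)
    fix S T assume *: "S \<in> Pow (tree_level m n)" "T \<in> Pow (tree_level m n)" "?f S = ?f T"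
    have "v \<in> S \<longleftrightarrow> v \<in> T" if "v \<in> tree_level m n" for v
      using mem[OF that, of S] mem[OF that, of T] *(3) by simp
    then show "S = T" using *(1,2) by blast
  qed
  moreover have "?f ` Pow (tree_level m n) \<subseteq> level_actions m (carrier (AutT m)) (Suc n)"
    using swap_below_in_AutT[OF m] by (auto simp: level_actions_def)
  ultimately have "card (Pow (tree_level m n)) \<le> card (level_actions m (carrier (AutT m)) (Suc n))"
    by (intro card_inj_on_le finite_level_actions) auto
  then show ?thesis
    by (simp add: card_Pow finite_tree_level card_tree_level)
qed

section \<open>Logarithmic growth rates and the Hausdorff dimension\<close>

text \<open>Unrolling gives \<open>c\<close> times a sum of \<open>j\<close> powers of
  \<open>r\<close>, each at most \<open>r ^ j\<close>. This form also covers \<open>r = 1\<close>,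
  which occurs for \<open>m = 2\<close> and \<open>n = 1\<close>.\<close>

lemma linear_recurrence_bound:
  fixes L :: "nat \<Rightarrow> real"
  assumes "L 0 = 0" "\<And>j. L (Suc j) \<le> c + r * L j" "r \<ge> 1" "c \<ge> 0"
  shows "L j \<le> c * real j * r ^ j"
proof (induction j)
  case (Suc j)
  have "L (Suc j) \<le> c + r * (c * real j * r ^ j)"
    using assms(2)[of j] mult_left_mono[OF Suc, of r] assms(3) by linarith
  also have "\<dots> \<le> c * r ^ Suc j + r * (c * real j * r ^ j)"
    using mult_left_mono[OF one_le_power[OF assms(3), of "Suc j"] assms(4)] by simp
  also have "\<dots> = c * real (Suc j) * r ^ Suc j"
    by (simp add: algebra_simps)
  finally show ?case .
qed (simp add: assms(1))

text \<open>The dimension is a lower limit, so it suffices to let the quotients tend to 0 along the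
  levels \<open>j * n\<close>, where the recursive bound can be iterated.\<close>

lemma hdim_nonpos_if_moving_centralizer:
  assumes m: "m \<ge> 2" and K: "subgroup K (AutT m)" and ss: "self_similar m K"
    and z: "z \<in> carrier (AutT m)" "z \<noteq> id" and comm: "\<And>k. k \<in> K \<Longrightarrow> k \<circ> z = z \<circ> k"
  shows "hdim m K \<le> 0"
proof -
  let ?A = "carrier (AutT m)"
  have sub: "K \<subseteq> ?A" using K by (rule subgroup.subset)
  have A: "subgroup ?A (AutT m)" using group.subgroup_self[OF group_AutT] .
  obtain v where moved: "z v \<noteq> v" using z(2) by (auto simp: fun_eq_iff)
  then have vw: "v \<in> tree_words m"
    using AutT_permutes[OF z(1)] by (meson permutes_not_in)
  define n where "n = length v"
  have v: "v \<in> tree_level m n" using vw by (simp add: tree_level_def n_def)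
  \<comment> \<open>The root is fixed, so the moved vertex has positive depth. This yields
    \<open>r \<ge> 1\<close> and makes \<open>j * n\<close> strictly increasing in
    \<open>j\<close>.\<close>
  have n: "n > 0" using moved AutT_root[OF z(1)] by (auto simp: n_def)
  define r where "r = m ^ n - 1"
  define D where "D = (\<lambda>j. ln (real (level_index m K j)))"
  define E where "E = (\<lambda>j. ln (real (level_index m ?A j)))"
  have "m ^ 1 \<le> m ^ n" using n m by (intro power_increasing) auto
  then have mn: "m ^ n \<ge> 2" using m by simp
  then have mn': "real (m ^ n) \<ge> 2"
    by (metis of_nat_le_iff of_nat_numeral)
  moreover have "real r = real (m ^ n) - 1"
    using mn by (simp add: r_def of_nat_diff)
  ultimately have r1: "real r \<ge> 1" and rmn: "real r / real (m ^ n) < 1"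
    by (simp_all add: divide_less_eq del: of_nat_power)
  have pos: "level_index m K j \<ge> 1" for j
  proof -
    have "level_actions m K j \<noteq> {}"
      using subgroup.one_closed[OF K] by (auto simp: level_actions_def)
    then show ?thesis
      using finite_level_actions[OF sub]
      by (simp add: level_index_eq_card[OF K] Suc_le_eq card_gt_0_iff)
  qed
  have Dpos: "D j \<ge> 0" for j
    using pos[of j] by (simp add: D_def)
  have D0: "D (0 * n) = 0"
  proof -
    have "tree_level m 0 = {[]}" by (auto simp: tree_level_def)
    then have "level_actions m K 0 = (\<lambda>_. restrict id {[]}) ` K"
      using sub unfolding level_actions_def
      by (intro image_cong) (auto simp: restrict_eq_iff AutT_root)
    moreover have "K \<noteq> {}" using subgroup.one_closed[OF K] by blast
    ultimately show ?thesis by (simp add: D_def level_index_eq_card[OF K] image_constant_conv)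
  qed
  have Dstep: "D (Suc j * n) \<le> D n + real r * D (j * n)" for j
  proof -
    have "level_index m K (n + j * n) \<le> level_index m K n * level_index m K (j * n) ^ r"
      unfolding level_index_eq_card[OF K] r_def
      by (rule card_level_actions_add_le[OF sub ss z(1) comm v moved])
    then have "real (level_index m K (Suc j * n)) \<le>
        real (level_index m K n) * real (level_index m K (j * n)) ^ r"
      by (metis mult_Suc of_nat_le_iff of_nat_mult of_nat_power)
    then have "D (Suc j * n) \<le> ln (real (level_index m K n) * real (level_index m K (j * n)) ^ r)"
      unfolding D_def using pos[of "Suc j * n"] by (intro ln_mono) simp_all
    also have "\<dots> = D n + real r * D (j * n)"
      using pos[of n] pos[of "j * n"] by (simp add: D_def ln_mult ln_realpow)
    finally show ?thesis .
  qed
  have Dle: "D (j * n) \<le> D n * real j * real r ^ j" for j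
    by (rule linear_recurrence_bound[of "\<lambda>j. D (j * n)"]) (fact D0 Dstep r1 Dpos)+
  \<comment> \<open>The divisor \<open>m\<close> pays for the shift by one level in the lower bound.
    At \<open>j = 0\<close> the inequality fails, since \<open>E 0 = 0\<close>.\<close>
  have Ege: "real m ^ (j * n) * (ln 2 / real m) \<le> E (j * n)" if j: "j > 0" for j
  proof -
    obtain l where l: "j * n = Suc l" using j n by (metis gr0_implies_Suc mult_pos_pos)
    have "real (2 ^ (m ^ l)) \<le> real (level_index m ?A (j * n))"
      using card_level_actions_AutT_ge[OF m, of l]
      unfolding l level_index_eq_card[OF A] by (simp only: of_nat_le_iff)
    then have "ln (real (2 ^ (m ^ l))) \<le> E (j * n)"
      unfolding E_def by (intro ln_mono) simp_all
    moreover have "ln (real (2 ^ (m ^ l))) = real m ^ (j * n) * (ln 2 / real m)"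
      using m by (simp add: ln_realpow l)
    ultimately show ?thesis by simp
  qed
  \<comment> \<open>The ratio of the two growth rates per block of \<open>n\<close> levels; losing
    one section makes it less than 1, so \<open>q ^ j\<close> beats the factor
    \<open>j\<close>.\<close>
  define q where "q = real r / real (m ^ n)"
  have "0 < q"
    unfolding q_def using r1 mn' by (intro divide_pos_pos) linarith+
  moreover have "q < 1" unfolding q_def by (rule rmn)
  ultimately have q: "0 < q" "q < 1" .
  define C where "C = D n / (ln 2 / real m)"
  have upper: "D (j * n) / E (j * n) \<le> C * (real j * q ^ j)" if j: "j > 0" for j
  proof -
    have p: "0 < real m ^ (j * n) * (ln 2 / real m)" using m by simp
    have "D (j * n) / E (j * n) \<le> (D n * real j * real r ^ j) / (real m ^ (j * n) * (ln 2 / real m))"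
      using Dle Ege[OF j] Dpos p r1 by (intro frac_le) auto
    also have "\<dots> = C * (real j * q ^ j)"
    proof -
      have "real m ^ (j * n) = real (m ^ n) ^ j"
        by (metis mult.commute of_nat_power power_mult)
      moreover have "a * b * s / (t * w) = a / w * (b * (s / t))" for a b s t w :: real
        by (simp add: ac_simps)
      ultimately show ?thesis unfolding C_def q_def power_divide by (simp only:)
    qed
    finally show ?thesis .
  qed
  have lim: "(\<lambda>j. C * (real j * q ^ j)) \<longlonglongrightarrow> 0"
    using powser_times_n_limit_0[of q] q by (intro tendsto_mult_right_zero) simp
  have "hdim m K = liminf (\<lambda>j. ereal (D j / E j))"
    by (simp add: hdim_def D_def E_def)
  \<comment> \<open>Passing to a subsequence can only increase a lower limit.\<close>
  also have "\<dots> \<le> liminf ((\<lambda>j. ereal (D j / E j)) \<circ> (\<lambda>j. j * n))"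
    by (rule liminf_subseq_mono) (use n in \<open>simp add: strict_mono_def\<close>)
  also have "\<dots> \<le> liminf (\<lambda>j. ereal (C * (real j * q ^ j)))"
    using upper by (intro Liminf_mono eventually_mono[OF eventually_gt_at_top[of 0]]) simp
  also have "\<dots> = 0"
    using lim_imp_Liminf[OF _ tendsto_ereal[OF lim]] by (simp add: zero_ereal_def)
  finally show ?thesis .
qed

theorem corollary4:
  fixes G :: "('a, 'b) monoid_scheme" and X :: "'a topology"
  assumes "profinite_group G X"
    and "group_center G \<noteq> {\<one>\<^bsub>G\<^esub>}"
  shows "\<not> (\<exists>m\<ge>2. \<exists>\<rho> \<in> hom G (AutT m).
    inj_on \<rho> (carrier G) \<and>
    closedin (AutT_topology m) (\<rho> ` carrier G) \<and>
    self_similar m (\<rho> ` carrier G) \<and>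
    level_transitive m (\<rho> ` carrier G) \<and>
    hdim m (\<rho> ` carrier G) > 0)"
proof safe
  fix m :: nat and \<rho>
  assume m: "m \<ge> 2" and \<rho>: "\<rho> \<in> hom G (AutT m)" and inj: "inj_on \<rho> (carrier G)"
    and ss: "self_similar m (\<rho> ` carrier G)" and pos: "hdim m (\<rho> ` carrier G) > 0"
  interpret G: group G
    using assms(1) by (simp add: profinite_group_def topological_group_def)
  interpret group_hom G "AutT m" \<rho>
    using \<rho> by (simp add: group_hom_def group_hom_axioms_def G.group_axioms group_AutT)
  have "\<one>\<^bsub>G\<^esub> \<in> group_center G" by (simp add: group_center_def)
  then obtain c where "c \<in> group_center G" "c \<noteq> \<one>\<^bsub>G\<^esub>"
    using assms(2) by blast
  then have c: "c \<in> carrier G" "c \<noteq> \<one>\<^bsub>G\<^esub>" "\<And>x. x \<in> carrier G \<Longrightarrow> c \<otimes>\<^bsub>G\<^esub> x = x \<otimes>\<^bsub>G\<^esub> c"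
    by (auto simp: group_center_def)
  \<comment> \<open>Injectivity keeps the central element non-trivial, and multiplicativity makes it
    commute with the whole image.\<close>
  have "\<rho> c \<noteq> id"
    using inj_onD[OF inj, of c "\<one>\<^bsub>G\<^esub>"] c by auto
  moreover have "k \<circ> \<rho> c = \<rho> c \<circ> k" if "k \<in> \<rho> ` carrier G" for k
    using that c hom_mult by (metis (no_types, lifting) AutT_simps(1) imageE)
  ultimately have "hdim m (\<rho> ` carrier G) \<le> 0"
    using c(1) by (intro hdim_nonpos_if_moving_centralizer[OF m img_is_subgroup ss, of "\<rho> c"]) auto
  with pos show False by simp
qed

end
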